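(* Let $\phi$ be a rank one Drinfeld $A$-module over $L$, let $l\in A$ be monic irreducible such that $\phi$ has good reduction at all primes of $L$ over $l$ and $l$ is unramified in $L_s/k$ ($L_s$ the maximal separable subextension of $L/k$), and let $\Gamma$ be a finitely generated $A$-submodule of $(L,+)$. Let $\Gamma'=\frac1l\Gamma\cap L$, $e(\Gamma'/\Gamma)$ the monic polynomial of smallest degree with $\phi_{e(\Gamma'/\Gamma)}(\Gamma')\subseteq\Gamma$, and $e_l(\Gamma)=\gcd(e(\Gamma'/\Gamma),l)$. Let $\Phi:\Gamma\to\mathrm{Hom}_A(H_\Gamma(l),\Lambda_l^\phi)$ be the $A$-module homomorphism $a\mapsto\Phi_a$, $\Phi_a(\sigma)=\sigma\alpha-\alpha$ where $\phi_l(\alpha)=a$, and let $\Gamma_\Phi=\ker\Phi$. Then $\phi_{e_l(\Gamma)}(\Gamma_\Phi)\subseteq\phi_l(\Gamma)$.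
   Context: Let $q$ be a prime power, $k=\mathbb{F}_q(T)$, $A=\mathbb{F}_q[T]$, $\bar k$ an algebraic closure of $k$, $L\subseteq\bar k$ a finite extension of $k$ (an $A$-field of generic characteristic). A rank one Drinfeld $A$-module over $L$ is a ring homomorphism $\phi:A\to\mathrm{End}_{\mathbb{F}_q}(\bar k,+)$ with $\phi_T(X)=TX+cX^q$, $0\ne c\in L$; $(L,+)$, $(\bar k,+)$ are $A$-modules via $\phi$. $\Lambda_l^\phi=\{\alpha:\phi_l(\alpha)=0\}$, $L_l=L(\Lambda_l^\phi)$, $\mathrm{Gal}(L_l/L)\cong(A/lA)^*$ via $\sigma_a(\lambda)=\phi_a(\lambda)$. $\frac1l\Gamma=\{\alpha\in\bar k:\phi_l(\alpha)\in\Gamma\}$, $L_{l,\Gamma}=L(\Lambda_l^\phi,\frac1l\Gamma)$, $H_\Gamma(l)=\mathrm{Gal}(L_{l,\Gamma}/L_l)$ with the $A$-module structure: for $a\in A$, $l\nmid a$, $a\cdot\tau=\tilde\sigma_a\tau\tilde\sigma_a^{-1}$ ($\tilde\sigma_a$ any extension of $\sigma_a$); in general write $a\equiv\sum a_i\pmod l$ with $l\nmid a_i$ and $a\cdot\tau=\sum_i a_i\cdot\tau$; equivalently $(a\cdot\tau)(\alpha)=\alpha+\phi_a(\lambda)$ if $\tau(\alpha)=\alpha+\lambda$, $\phi_l(\alpha)\in\Gamma$. *)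

theory Defs
  imports
    "HOL-Algebra.QuotRing"
    "HOL-Algebra.Generated_Fields"
    "HOL-Algebra.Algebraic_Closure_Type"
    "HOL-Library.Cardinality"
begin

text \<open>
  The finite field of constants is the type \<open>'f\<close>, so \<open>q = CARD('f)\<close>, \<open>A = 'f poly\<close> and
  \<open>k = 'f poly fract\<close>.  All fields over \<open>k\<close> are subsets of the algebraic closure of \<open>k\<close>.
\<close>

type_synonym 'f kbar = "'f poly fract alg_closure"

abbreviation kbar_ring :: "'f::field kbar ring" where
  "kbar_ring \<equiv> ring_of_type_algebra"

definition of_A :: "'f::field poly \<Rightarrow> 'f kbar" where
  "of_A a = to_ac (to_fract a)"

definition base_field :: "'f::field kbar set" where
  "base_field = range to_ac"

definition finite_extension :: "'f::field kbar set \<Rightarrow> bool" where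
  "finite_extension L \<longleftrightarrow>
     subfield L kbar_ring \<and> base_field \<subseteq> L \<and> ring.finite_dimension kbar_ring base_field L"

definition adjoin :: "'f::field kbar set \<Rightarrow> 'f kbar set \<Rightarrow> 'f kbar set" where
  "adjoin K S = generate_field kbar_ring (K \<union> S)"

text \<open>
  Elements of the Galois group of \<open>M/K\<close> are functions on \<open>M\<close>, extended by \<open>undefined\<close>.
\<close>

definition Gal :: "'f::field kbar set \<Rightarrow> 'f kbar set \<Rightarrow> ('f kbar \<Rightarrow> 'f kbar) set" where
  "Gal M K = {\<sigma> \<in> extensional M.
     \<sigma> \<in> ring_iso (kbar_ring\<lparr>carrier := M\<rparr>) (kbar_ring\<lparr>carrier := M\<rparr>) \<and> (\<forall>x\<in>K. \<sigma> x = x)}"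

definition separable_over_k :: "'f::field kbar \<Rightarrow> bool" where
  "separable_over_k x \<longleftrightarrow>
     (\<exists>p :: 'f poly fract poly. Factorial_Ring.irreducible p \<and> poly (map_poly to_ac p) x = 0 \<and>
        rsquarefree (map_poly to_ac p))"

definition max_separable :: "'f::field kbar set \<Rightarrow> 'f kbar set" where
  "max_separable L = {x \<in> L. separable_over_k x}"


text \<open>
  A prime of \<open>K\<close> is given by its normalized discrete valuation; only the values on \<open>K - {0}\<close>
  matter.
\<close>

definition prime_of :: "'f::field kbar set \<Rightarrow> ('f kbar \<Rightarrow> int) \<Rightarrow> bool" where
  "prime_of K v \<longleftrightarrow>
     (\<forall>x\<in>K - {0}. \<forall>y\<in>K - {0}. v (x * y) = v x + v y) \<and>
     (\<forall>x\<in>K - {0}. \<forall>y\<in>K - {0}. x + y \<noteq> 0 \<longrightarrow> min (v x) (v y) \<le> v (x + y)) \<and>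
     v ` (K - {0}) = UNIV"

definition prime_over :: "'f::field kbar set \<Rightarrow> 'f poly \<Rightarrow> ('f kbar \<Rightarrow> int) \<Rightarrow> bool" where
  "prime_over K l v \<longleftrightarrow> prime_of K v \<and>
     (\<forall>a. a \<noteq> 0 \<longrightarrow> 0 \<le> v (of_A a) \<and> (0 < v (of_A a) \<longleftrightarrow> l dvd a))"

text \<open>
  As \<open>l\<close> is a uniformizer of \<open>k\<close> at \<open>l\<close> and \<open>v\<close> is normalized, \<open>v l\<close> is the ramification
  index of \<open>v\<close> over \<open>l\<close>.  Residue fields are finite, hence residue extensions are separable.
\<close>

definition ramification_index :: "'f::field poly \<Rightarrow> ('f kbar \<Rightarrow> int) \<Rightarrow> int" where
  "ramification_index l v = v (of_A l)"

definition unramified_in :: "'f::field poly \<Rightarrow> 'f kbar set \<Rightarrow> bool" where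
  "unramified_in l K \<longleftrightarrow> (\<forall>v. prime_over K l v \<longrightarrow> ramification_index l v = 1)"


text \<open>
  \<open>Modules.module \<phi>\<close> says that \<open>a \<mapsto> \<phi> a\<close> is a unital ring homomorphism from \<open>A\<close> to the
  additive endomorphisms of the algebraic closure; the condition on constants makes it a
  homomorphism of algebras over the constant field (and then each \<open>\<phi> a\<close> is linear over it).
  The element \<open>c\<close> is the leading coefficient of \<open>\<phi>\<close> at \<open>T\<close>.
\<close>

definition drinfeld_rank_one ::
    "'f::{finite,field} kbar set \<Rightarrow> 'f kbar \<Rightarrow> ('f poly \<Rightarrow> 'f kbar \<Rightarrow> 'f kbar) \<Rightarrow> bool" where
  "drinfeld_rank_one L c \<phi> \<longleftrightarrow>
     Modules.module \<phi> \<and>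
     (\<forall>z x. \<phi> [:z:] x = of_A [:z:] * x) \<and>
     c \<in> L \<and> c \<noteq> 0 \<and>
     (\<forall>x. \<phi> [:0, 1:] x = of_A [:0, 1:] * x + c * x ^ CARD('f))"

definition drinfeld_module_rank_one ::
    "'f::{finite,field} kbar set \<Rightarrow> ('f poly \<Rightarrow> 'f kbar \<Rightarrow> 'f kbar) \<Rightarrow> bool" where
  "drinfeld_module_rank_one L \<phi> \<longleftrightarrow> (\<exists>c. drinfeld_rank_one L c \<phi>)"

text \<open>
  Good reduction at \<open>v\<close>: \<open>\<phi>\<close> is isomorphic over \<open>L\<close>, by \<open>x \<mapsto> u * x\<close>, to some \<open>\<psi>\<close> with
  coefficients in the valuation ring of \<open>v\<close> whose reduction still has rank one, that is, whose
  leading coefficient \<open>c\<close> is a unit at \<open>v\<close>.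
\<close>

definition good_reduction ::
    "'f::{finite,field} kbar set \<Rightarrow> ('f poly \<Rightarrow> 'f kbar \<Rightarrow> 'f kbar) \<Rightarrow> ('f kbar \<Rightarrow> int) \<Rightarrow> bool" where
  "good_reduction L \<phi> v \<longleftrightarrow>
     (\<exists>u\<in>L - {0}. \<exists>\<psi> c. drinfeld_rank_one L c \<psi> \<and> (\<forall>a x. u * \<phi> a x = \<psi> a (u * x)) \<and>
        0 \<le> v (of_A [:0, 1:]) \<and> v c = 0)"

definition fg_submodule ::
    "('f::field poly \<Rightarrow> 'f kbar \<Rightarrow> 'f kbar) \<Rightarrow> 'f kbar set \<Rightarrow> 'f kbar set \<Rightarrow> bool" where
  "fg_submodule \<phi> L \<Gamma> \<longleftrightarrow>
     Modules.module.subspace \<phi> \<Gamma> \<and> \<Gamma> \<subseteq> L \<and> (\<exists>S. finite S \<and> Modules.module.span \<phi> S = \<Gamma>)"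

definition torsion :: "('f::field poly \<Rightarrow> 'f kbar \<Rightarrow> 'f kbar) \<Rightarrow> 'f poly \<Rightarrow> 'f kbar set" where
  "torsion \<phi> l = {\<alpha>. \<phi> l \<alpha> = 0}"

definition division_points ::
    "('f::field poly \<Rightarrow> 'f kbar \<Rightarrow> 'f kbar) \<Rightarrow> 'f poly \<Rightarrow> 'f kbar set \<Rightarrow> 'f kbar set" where
  "division_points \<phi> l \<Gamma> = {\<alpha>. \<phi> l \<alpha> \<in> \<Gamma>}"

definition torsion_field ::
    "'f::field kbar set \<Rightarrow> ('f poly \<Rightarrow> 'f kbar \<Rightarrow> 'f kbar) \<Rightarrow> 'f poly \<Rightarrow> 'f kbar set" where
  "torsion_field L \<phi> l = adjoin L (torsion \<phi> l)"

definition kummer_field ::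
    "'f::field kbar set \<Rightarrow> ('f poly \<Rightarrow> 'f kbar \<Rightarrow> 'f kbar) \<Rightarrow> 'f poly \<Rightarrow> 'f kbar set \<Rightarrow> 'f kbar set" where
  "kummer_field L \<phi> l \<Gamma> = adjoin L (torsion \<phi> l \<union> division_points \<phi> l \<Gamma>)"

definition kummer_group ::
    "'f::field kbar set \<Rightarrow> ('f poly \<Rightarrow> 'f kbar \<Rightarrow> 'f kbar) \<Rightarrow> 'f poly \<Rightarrow> 'f kbar set \<Rightarrow>
     ('f kbar \<Rightarrow> 'f kbar) set" where
  "kummer_group L \<phi> l \<Gamma> = Gal (kummer_field L \<phi> l \<Gamma>) (torsion_field L \<phi> l)"

text \<open>
  The element \<open>a \<cdot> \<tau>\<close> is determined by its values on the division points, since these generate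
  the Kummer field over the torsion field.
\<close>

definition kummer_smult ::
    "'f::field kbar set \<Rightarrow> ('f poly \<Rightarrow> 'f kbar \<Rightarrow> 'f kbar) \<Rightarrow> 'f poly \<Rightarrow> 'f kbar set \<Rightarrow>
     'f poly \<Rightarrow> ('f kbar \<Rightarrow> 'f kbar) \<Rightarrow> 'f kbar \<Rightarrow> 'f kbar" where
  "kummer_smult L \<phi> l \<Gamma> a \<tau> =
     (THE \<tau>'. \<tau>' \<in> kummer_group L \<phi> l \<Gamma> \<and>
        (\<forall>\<alpha>\<in>division_points \<phi> l \<Gamma>. \<tau>' \<alpha> = \<alpha> + \<phi> a (\<tau> \<alpha> - \<alpha>)))"

text \<open>
  Modules over \<open>A\<close> as records; the multiplicative components of the record are irrelevant.
\<close>

definition kummer_module ::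
    "'f::field kbar set \<Rightarrow> ('f poly \<Rightarrow> 'f kbar \<Rightarrow> 'f kbar) \<Rightarrow> 'f poly \<Rightarrow> 'f kbar set \<Rightarrow>
     ('f poly, 'f kbar \<Rightarrow> 'f kbar) module" where
  "kummer_module L \<phi> l \<Gamma> =
     \<lparr>carrier = kummer_group L \<phi> l \<Gamma>, monoid.mult = undefined, one = undefined,
      ring.zero = restrict id (kummer_field L \<phi> l \<Gamma>), add = compose (kummer_field L \<phi> l \<Gamma>),
      module.smult = kummer_smult L \<phi> l \<Gamma>\<rparr>"

definition submodule_via ::
    "('f::field poly \<Rightarrow> 'f kbar \<Rightarrow> 'f kbar) \<Rightarrow> 'f kbar set \<Rightarrow> ('f poly, 'f kbar) module" where
  "submodule_via \<phi> S =
     \<lparr>carrier = S, monoid.mult = undefined, one = undefined, ring.zero = 0, add = (+), module.smult = \<phi>\<rparr>"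

definition Hom_module ::
    "('r, 'b) module \<Rightarrow> ('r, 'c) module \<Rightarrow> ('r, 'b \<Rightarrow> 'c) module" where
  "Hom_module M N =
     \<lparr>carrier = {f \<in> carrier M \<rightarrow>\<^sub>E carrier N.
        (\<forall>x\<in>carrier M. \<forall>y\<in>carrier M. f (x \<oplus>\<^bsub>M\<^esub> y) = f x \<oplus>\<^bsub>N\<^esub> f y) \<and>
        (\<forall>a. \<forall>x\<in>carrier M. f (a \<odot>\<^bsub>M\<^esub> x) = a \<odot>\<^bsub>N\<^esub> f x)},
      monoid.mult = undefined, one = undefined,
      ring.zero = (\<lambda>x\<in>carrier M. \<zero>\<^bsub>N\<^esub>),
      add = (\<lambda>f g. \<lambda>x\<in>carrier M. f x \<oplus>\<^bsub>N\<^esub> g x),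
      module.smult = (\<lambda>a f. \<lambda>x\<in>carrier M. a \<odot>\<^bsub>N\<^esub> f x)\<rparr>"

text \<open>
  The value does not depend on the chosen \<open>\<alpha>\<close>: two choices differ by a torsion point, which
  the Kummer group fixes.
\<close>

definition kummer_map ::
    "'f::field kbar set \<Rightarrow> ('f poly \<Rightarrow> 'f kbar \<Rightarrow> 'f kbar) \<Rightarrow> 'f poly \<Rightarrow> 'f kbar set \<Rightarrow>
     'f kbar \<Rightarrow> ('f kbar \<Rightarrow> 'f kbar) \<Rightarrow> 'f kbar" where
  "kummer_map L \<phi> l \<Gamma> a =
     (\<lambda>\<sigma>\<in>kummer_group L \<phi> l \<Gamma>. let \<alpha> = (SOME \<alpha>. \<phi> l \<alpha> = a) in \<sigma> \<alpha> - \<alpha>)"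

definition kummer_kernel ::
    "'f::field kbar set \<Rightarrow> ('f poly \<Rightarrow> 'f kbar \<Rightarrow> 'f kbar) \<Rightarrow> 'f poly \<Rightarrow> 'f kbar set \<Rightarrow> 'f kbar set" where
  "kummer_kernel L \<phi> l \<Gamma> =
     a_kernel (submodule_via \<phi> \<Gamma>)
       (Hom_module (kummer_module L \<phi> l \<Gamma>) (submodule_via \<phi> (torsion \<phi> l)))
       (kummer_map L \<phi> l \<Gamma>)"

definition module_exponent ::
    "('f::field poly \<Rightarrow> 'f kbar \<Rightarrow> 'f kbar) \<Rightarrow> 'f kbar set \<Rightarrow> 'f kbar set \<Rightarrow> 'f poly" where
  "module_exponent \<phi> \<Gamma>' \<Gamma> = (ARG_MIN degree e. lead_coeff e = 1 \<and> \<phi> e ` \<Gamma>' \<subseteq> \<Gamma>)"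

definition e_l ::
    "'f::field_gcd kbar set \<Rightarrow> ('f poly \<Rightarrow> 'f kbar \<Rightarrow> 'f kbar) \<Rightarrow> 'f poly \<Rightarrow> 'f kbar set \<Rightarrow> 'f poly" where
  "e_l L \<phi> l \<Gamma> = gcd (module_exponent \<phi> (division_points \<phi> l \<Gamma> \<inter> L) \<Gamma>) l"

end

theory Submission
  imports Defs
begin

text \<open>
  Let \<open>\<phi> l \<alpha> = a\<close> with \<open>a\<close> in the kernel of the Kummer map.  The Kummer group fixes \<open>\<alpha>\<close>, and
  \<open>\<alpha>\<close> is separable over the torsion field because \<open>\<phi> l\<close> has constant derivative \<open>l \<noteq> 0\<close>, so
  \<open>\<alpha>\<close> lies in the torsion field.  The Galois group of the torsion field over \<open>L\<close> acts on the
  torsion, a one-dimensional vector space over \<open>A / l\<close>, by scalars, so its first cohomology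
  with values in the torsion vanishes and \<open>a = \<phi> l \<beta>\<close> with \<open>\<beta> \<in> L\<close>.  Both \<open>l\<close> and the
  exponent \<open>e(\<Gamma>'/\<Gamma>)\<close> carry \<open>\<beta>\<close> into \<open>\<Gamma>\<close>, hence so does their gcd.
\<close>

section \<open>Subrings and subfields of a field type\<close>

lemma ring_of_type_algebra_simps [simp]:
  "carrier (ring_of_type_algebra :: 'a::ring_1 ring) = UNIV"
  "\<zero>\<^bsub>(ring_of_type_algebra :: 'a ring)\<^esub> = 0"
  "\<one>\<^bsub>(ring_of_type_algebra :: 'a ring)\<^esub> = 1"
  "x \<oplus>\<^bsub>ring_of_type_algebra\<^esub> (y :: 'a) = x + y"
  "x \<otimes>\<^bsub>ring_of_type_algebra\<^esub> (y :: 'a) = x * y"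
  by (simp_all add: ring_of_type_algebra_def)

lemma a_inv_ring_of_type_algebra [simp]:
  "\<ominus>\<^bsub>ring_of_type_algebra\<^esub> (x :: 'a::field) = - x"
proof -
  interpret field "ring_of_type_algebra :: 'a ring" by (rule field_from_type_algebra)
  show ?thesis
    using minus_equality[of "- x" x] by simp
qed

lemma m_inv_ring_of_type_algebra [simp]:
  assumes "x \<noteq> 0"
  shows "inv\<^bsub>ring_of_type_algebra\<^esub> (x :: 'a::field) = inverse x"
proof -
  interpret field "ring_of_type_algebra :: 'a ring" by (rule field_from_type_algebra)
  show ?thesis
    using inv_unique'[of x "inverse x"] assms by simp
qed

lemma subring_type_iff:
  "subring R (ring_of_type_algebra :: 'a::field ring) \<longleftrightarrow>
     1 \<in> R \<and> (\<forall>x\<in>R. \<forall>y\<in>R. x - y \<in> R \<and> x * y \<in> R)"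
proof
  assume R: "subring R (ring_of_type_algebra :: 'a ring)"
  have "x - y \<in> R" if "x \<in> R" "y \<in> R" for x y
    using subringE(7)[OF R that(1) subringE(5)[OF R that(2)]] by simp
  then show "1 \<in> R \<and> (\<forall>x\<in>R. \<forall>y\<in>R. x - y \<in> R \<and> x * y \<in> R)"
    using subringE(3,6)[OF R] by simp
next
  interpret field "ring_of_type_algebra :: 'a ring" by (rule field_from_type_algebra)
  assume R: "1 \<in> R \<and> (\<forall>x\<in>R. \<forall>y\<in>R. x - y \<in> R \<and> x * y \<in> R)"
  then have 0: "0 \<in> R"
    by (metis diff_self)
  then have m: "- x \<in> R" if "x \<in> R" for x
    using R that by (metis diff_0)
  then have "x + y \<in> R" if "x \<in> R" "y \<in> R" for x y
    using R that by (metis diff_minus_eq_add)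
  with R m show "subring R (ring_of_type_algebra :: 'a ring)"
    by (intro subringI) auto
qed

lemma subfield_type_iff:
  "subfield K (ring_of_type_algebra :: 'a::field ring) \<longleftrightarrow>
     subring K (ring_of_type_algebra :: 'a ring) \<and> (\<forall>x\<in>K. inverse x \<in> K)"
proof -
  interpret field "ring_of_type_algebra :: 'a ring" by (rule field_from_type_algebra)
  show ?thesis
  proof
    assume K: "subfield K (ring_of_type_algebra :: 'a ring)"
    have "inverse x \<in> K" if "x \<in> K" for x
      using subfield_m_inv(1)[OF K, of x] that by (cases "x = 0") auto
    with subfieldE(1)[OF K]
    show "subring K (ring_of_type_algebra :: 'a ring) \<and> (\<forall>x\<in>K. inverse x \<in> K)" by simp
  next
    assume "subring K (ring_of_type_algebra :: 'a ring) \<and> (\<forall>x\<in>K. inverse x \<in> K)"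
    then show "subfield K (ring_of_type_algebra :: 'a ring)"
      by (intro subfieldI') auto
  qed
qed

context
  fixes R :: "'a::field set"
  assumes R: "subring R (ring_of_type_algebra :: 'a ring)"
begin

lemma subring_type_closed:
  shows "0 \<in> R" "1 \<in> R"
    and "x \<in> R \<Longrightarrow> y \<in> R \<Longrightarrow> x + y \<in> R"
    and "x \<in> R \<Longrightarrow> y \<in> R \<Longrightarrow> x - y \<in> R"
    and "x \<in> R \<Longrightarrow> y \<in> R \<Longrightarrow> x * y \<in> R"
    and "x \<in> R \<Longrightarrow> - x \<in> R"
  using subringE[OF R] R[unfolded subring_type_iff] by auto

lemma subring_type_sum: "(\<And>i. i \<in> I \<Longrightarrow> f i \<in> R) \<Longrightarrow> sum f I \<in> R"
  by (induction I rule: infinite_finite_induct) (auto intro: subring_type_closed)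

lemma subring_type_poly: "(\<And>i. coeff p i \<in> R) \<Longrightarrow> x \<in> R \<Longrightarrow> poly p x \<in> R"
proof (induction p)
  case (pCons a p)
  have "a \<in> R" "\<And>i. coeff p i \<in> R"
    using pCons.prems(1)[of 0] pCons.prems(1)[of "Suc i" for i] by auto
  with pCons show ?case by (auto intro: subring_type_closed)
qed (auto intro: subring_type_closed)

lemma subring_type_coeff_mult:
  "(\<And>i. coeff p i \<in> R) \<Longrightarrow> (\<And>i. coeff q i \<in> R) \<Longrightarrow> coeff (p * q) i \<in> R"
  by (auto simp: coeff_mult intro: subring_type_closed subring_type_sum)

lemma subring_type_coeff_power: "(\<And>i. coeff p i \<in> R) \<Longrightarrow> coeff (p ^ n) i \<in> R"
  by (induction n arbitrary: i) (auto simp: subring_type_closed subring_type_coeff_mult)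

end

text \<open>The ambient field is the whole type, so algebraicity is a property of \<open>K\<close>
  alone and passes to larger sets.\<close>

definition algebraic_type :: "'a::field set \<Rightarrow> bool" where
  "algebraic_type K \<longleftrightarrow> (\<forall>x. \<exists>p. p \<noteq> 0 \<and> (\<forall>i. coeff p i \<in> K) \<and> poly p x = 0)"

lemma algebraic_type_mono: "algebraic_type K \<Longrightarrow> K \<subseteq> M \<Longrightarrow> algebraic_type M"
  unfolding algebraic_type_def by (meson subsetD)

text \<open>The inverse of \<open>x\<close> is a polynomial in \<open>x\<close>: an equation
  \<open>c + x * r(x) = 0\<close> with \<open>c \<noteq> 0\<close> gives
  \<open>inverse x = - r(x) / c\<close>. This makes a field out of the domain of a homomorphism,
  which is only known to be a ring.\<close>

lemma subring_algebraic_imp_subfield: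
  fixes K R :: "'a::field set"
  assumes K: "subfield K (ring_of_type_algebra :: 'a ring)" and alg: "algebraic_type K"
    and R: "subring R (ring_of_type_algebra :: 'a ring)" and "K \<subseteq> R"
  shows "subfield R (ring_of_type_algebra :: 'a ring)"
  unfolding subfield_type_iff
proof (intro conjI ballI R)
  fix x assume x: "x \<in> R"
  \<comment> \<open>Since \<open>x \<noteq> 0\<close>, powers of the variable can be divided out of
    an annihilating polynomial until its constant term is nonzero.\<close>
  have nz: "\<exists>p. coeff p 0 \<noteq> 0 \<and> (\<forall>i. coeff p i \<in> K) \<and> poly p x = 0"
    if "p \<noteq> 0" "\<forall>i. coeff p i \<in> K" "poly p x = 0" "x \<noteq> 0" for p
    using that
  proof (induction p)
    case (pCons a p)
    have p: "\<forall>i. coeff p i \<in> K"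
      using pCons.prems(2) by (metis coeff_pCons_Suc)
    show ?case
    proof (cases "a = 0")
      case True
      with pCons p show ?thesis by auto
    next
      case False
      with pCons show ?thesis by (intro exI[of _ "pCons a p"]) auto
    qed
  qed auto
  show "inverse x \<in> R"
  proof (cases "x = 0")
    case False
    with nz alg obtain p where p: "coeff p 0 \<noteq> 0" "\<forall>i. coeff p i \<in> K" "poly p x = 0"
      unfolding algebraic_type_def by metis
    obtain c r where c: "p = pCons c r" by (cases p)
    have "c \<in> K" "\<And>i. coeff r i \<in> K"
      using p(2) c by (metis coeff_pCons_0, metis coeff_pCons_Suc)
    then have "inverse c \<in> R" "poly r x \<in> R"
      using K \<open>K \<subseteq> R\<close> by (auto simp: subfield_type_iff intro!: subring_type_poly[OF R _ x])
    then have "- (poly r x * inverse c) \<in> R"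
      by (auto intro: subring_type_closed[OF R])
    moreover have "- (poly r x * inverse c) = inverse x"
    proof -
      have "x * poly r x = - c"
        using p(3) c by (simp add: eq_neg_iff_add_eq_0 add.commute)
      with p(1) c show ?thesis
        by (intro inverse_unique[symmetric]) (simp add: mult.assoc[symmetric])
    qed
    ultimately show ?thesis by simp
  qed (auto simp: subring_type_closed[OF R])
qed

section \<open>Extending homomorphisms\<close>

text \<open>
  Homomorphisms from a subring to the whole field are handled through their graphs, so that
  unions of chains need no gluing of functions.
\<close>

definition hom_graph :: "('a::field \<times> 'a) set \<Rightarrow> bool" where
  "hom_graph F \<longleftrightarrow> (1, 1) \<in> F \<and>
     (\<forall>x x' y y'. (x, x') \<in> F \<longrightarrow> (y, y') \<in> F \<longrightarrow>
        (x - y, x' - y') \<in> F \<and> (x * y, x' * y') \<in> F) \<and>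
     (\<forall>y. (0, y) \<in> F \<longrightarrow> y = 0)"

context
  fixes F :: "('a::field \<times> 'a) set"
  assumes F: "hom_graph F"
begin

lemma hom_graph_closed:
  shows "(0, 0) \<in> F" "(1, 1) \<in> F"
    and "(x, x') \<in> F \<Longrightarrow> (y, y') \<in> F \<Longrightarrow> (x + y, x' + y') \<in> F"
    and "(x, x') \<in> F \<Longrightarrow> (y, y') \<in> F \<Longrightarrow> (x - y, x' - y') \<in> F"
    and "(x, x') \<in> F \<Longrightarrow> (y, y') \<in> F \<Longrightarrow> (x * y, x' * y') \<in> F"
    and "(0, y) \<in> F \<Longrightarrow> y = 0"
proof -
  have d: "(x - y, x' - y') \<in> F" if "(x, x') \<in> F" "(y, y') \<in> F" for x x' y y'
    using F that unfolding hom_graph_def by blast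
  show 0: "(0, 0) \<in> F"
    using d[of 1 1 1 1] F unfolding hom_graph_def by simp
  show "(x + y, x' + y') \<in> F" if "(x, x') \<in> F" "(y, y') \<in> F"
    using d[OF that(1) d[OF 0 that(2)]] by simp
qed (use F in \<open>unfold hom_graph_def, blast+\<close>)

text \<open>Single-valuedness at \<open>0\<close> is enough: two values at \<open>x\<close> differ
  by a value at \<open>0\<close>.\<close>

lemma hom_graph_unique: "(x, y) \<in> F \<Longrightarrow> (x, z) \<in> F \<Longrightarrow> y = z"
  using hom_graph_closed(4)[of x y x z] hom_graph_closed(6)[of "y - z"] by simp

lemma hom_graph_sum: "(\<And>i. i \<in> I \<Longrightarrow> (f i, g i) \<in> F) \<Longrightarrow> (sum f I, sum g I) \<in> F"
  by (induction I rule: infinite_finite_induct) (auto intro: hom_graph_closed)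

lemma subring_Domain: "subring (Domain F) (ring_of_type_algebra :: 'a ring)"
  unfolding subring_type_iff by (fastforce intro: hom_graph_closed)

end

section \<open>Images of polynomials under a homomorphism, and minimal polynomials\<close>

definition poly_graph :: "('a::field \<times> 'a) set \<Rightarrow> 'a poly \<Rightarrow> 'a poly \<Rightarrow> bool" where
  "poly_graph F p q \<longleftrightarrow> (\<forall>i. (coeff p i, coeff q i) \<in> F)"

lemma poly_graph_exists:
  assumes F: "hom_graph F" and p: "\<And>i. coeff p i \<in> Domain F"
  shows "\<exists>q. poly_graph F p q"
  using p
proof (induction p)
  case 0
  show ?case
    by (intro exI[of _ 0]) (simp add: poly_graph_def hom_graph_closed[OF F])
next
  case (pCons a p)
  have "\<And>i. coeff p i \<in> Domain F"
    using pCons.prems by (metis coeff_pCons_Suc)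
  then obtain q where q: "poly_graph F p q"
    using pCons.IH by blast
  obtain b where "(a, b) \<in> F"
    using pCons.prems[of 0] by auto
  with q have "poly_graph F (pCons a p) (pCons b q)"
    by (auto simp: poly_graph_def coeff_pCons split: nat.split)
  then show ?case by blast
qed

context
  fixes F :: "('a::field \<times> 'a) set"
  assumes F: "hom_graph F"
begin

lemma poly_graph_closed:
  assumes "poly_graph F p p'" "poly_graph F q q'"
  shows "poly_graph F (p - q) (p' - q')" "poly_graph F (p * q) (p' * q')"
  using assms unfolding poly_graph_def coeff_mult
  by (auto intro!: hom_graph_closed[OF F] hom_graph_sum[OF F])

lemma poly_graph_monom: "(a, b) \<in> F \<Longrightarrow> poly_graph F (monom a n) (monom b n)"
  by (auto simp: poly_graph_def hom_graph_closed[OF F])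

lemma poly_graph_0: "poly_graph F 0 q \<Longrightarrow> q = 0"
  using hom_graph_closed(6)[OF F] by (intro poly_eqI) (auto simp: poly_graph_def)

end

definition is_min_poly :: "'a::field set \<Rightarrow> 'a \<Rightarrow> 'a poly \<Rightarrow> bool" where
  "is_min_poly K x m \<longleftrightarrow> lead_coeff m = 1 \<and> (\<forall>i. coeff m i \<in> K) \<and> poly m x = 0 \<and>
     (\<forall>p. p \<noteq> 0 \<longrightarrow> (\<forall>i. coeff p i \<in> K) \<longrightarrow> poly p x = 0 \<longrightarrow> degree m \<le> degree p)"

lemma is_min_poly_exists:
  fixes K :: "'a::field set"
  assumes K: "subfield K (ring_of_type_algebra :: 'a ring)" and alg: "algebraic_type K"
  shows "\<exists>m. is_min_poly K x m"
proof -
  let ?P = "\<lambda>p. p \<noteq> 0 \<and> (\<forall>i. coeff p i \<in> K) \<and> poly p x = 0"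
  obtain p where p: "?P p" "\<And>q. ?P q \<Longrightarrow> degree p \<le> degree q"
    using alg ex_has_least_nat[of ?P _ degree] unfolding algebraic_type_def by metis
  have "inverse (lead_coeff p) \<in> K"
    using K p(1) by (auto simp: subfield_type_iff)
  then have "is_min_poly K x (smult (inverse (lead_coeff p)) p)"
    using p subring_type_closed(5)[OF subfieldE(1)[OF K]] by (auto simp: is_min_poly_def)
  then show ?thesis ..
qed

text \<open>Division by the minimal polynomial, carried out simultaneously on both sides of \<open>F\<close>.\<close>

lemma is_min_poly_dvd_graph:
  assumes F: "hom_graph F" and m: "is_min_poly (Domain F) x m" and m': "poly_graph F m m'"
    and "poly_graph F p q" and "poly p x = 0"
  shows "m' dvd q"
  using assms(4,5)
proof (induction "degree p" arbitrary: p q rule: less_induct)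
  case less
  show ?case
  proof (cases "p = 0")
    case True
    with less.prems poly_graph_0[OF F] show ?thesis by auto
  next
    case False
    define k where "k = degree p - degree m"
    have "degree m \<le> degree p"
      using m less.prems False unfolding is_min_poly_def poly_graph_def by blast
    \<comment> \<open>The partner of \<open>a\<close> under \<open>F\<close> is the coefficient of
      \<open>q\<close> at the degree of \<open>p\<close>, whatever the degree of \<open>q\<close>
      is.\<close>
    define a b where "a = lead_coeff p" and "b = coeff q (degree p)"
    have ab: "(a, b) \<in> F"
      using less.prems(1) by (simp add: poly_graph_def a_def b_def)
    \<comment> \<open>One step of long division cancels the leading term of \<open>p\<close>; the
      corresponding multiple of \<open>m'\<close> is subtracted from \<open>q\<close>.\<close>
    define p1 q1 where "p1 = p - monom a k * m" and "q1 = q - monom b k * m'"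
    have pg: "poly_graph F p1 q1"
      unfolding p1_def q1_def
      by (intro poly_graph_closed[OF F] poly_graph_monom[OF F] less.prems ab m')
    have root: "poly p1 x = 0"
      using less.prems m by (simp add: p1_def is_min_poly_def)
    have a0: "a \<noteq> 0" and m0: "m \<noteq> 0"
      using False m by (auto simp: a_def is_min_poly_def)
    have deg: "degree (monom a k * m) = degree p"
      using a0 m0 \<open>degree m \<le> degree p\<close> by (simp add: degree_mult_eq degree_monom_eq k_def)
    have lc: "coeff (monom a k * m) (degree p) = a"
      using lead_coeff_mult[of "monom a k" m] m deg by (simp add: is_min_poly_def degree_monom_eq a0)
    have "m' dvd q1"
    proof (cases "p1 = 0")
      case True
      with pg poly_graph_0[OF F] show ?thesis by auto
    next
      case p1: False
      have "coeff p1 (degree p) = 0"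
        using lc by (simp add: p1_def a_def)
      moreover have "degree p1 \<le> degree p"
        unfolding p1_def by (intro degree_diff_le) (simp_all add: deg)
      ultimately have "degree p1 < degree p"
        using p1 by (metis le_neq_implies_less leading_coeff_0_iff)
      then show ?thesis
        using less.hyps pg root by blast
    qed
    moreover have "q = q1 + monom b k * m'"
      by (simp add: q1_def)
    ultimately show ?thesis by simp
  qed
qed

text \<open>The candidate for the extension of \<open>F\<close> to the ring generated by its domain
  and \<open>x\<close>, with \<open>x\<close> sent to \<open>x'\<close>. Nothing here makes it
  single-valued yet.\<close>

definition adjoin_graph :: "('a::field \<times> 'a) set \<Rightarrow> 'a \<Rightarrow> 'a \<Rightarrow> ('a \<times> 'a) set" where
  "adjoin_graph F x x' = {(poly p x, poly q x') |p q. poly_graph F p q}"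

text \<open>Only single-valuedness is in question. If \<open>p\<close> vanishes at \<open>x\<close>,
  then \<open>m'\<close> divides the image of \<open>p\<close>, which therefore vanishes at the root
  \<open>x'\<close> of \<open>m'\<close>.\<close>

lemma adjoin_graph:
  assumes F: "hom_graph F" and m: "is_min_poly (Domain F) x m" and m': "poly_graph F m m'"
    and root: "poly m' x' = 0"
  shows "hom_graph (adjoin_graph F x x')" "F \<subseteq> adjoin_graph F x x'"
    "(x, x') \<in> adjoin_graph F x x'"
proof -
  have mono: "(poly (monom a n) x, poly (monom b n) x') \<in> adjoin_graph F x x'"
    if "(a, b) \<in> F" for a b n
    unfolding adjoin_graph_def using poly_graph_monom[OF F that, of n] by blast
  show sub: "F \<subseteq> adjoin_graph F x x'"
  proof
    fix z assume "z \<in> F"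
    then show "z \<in> adjoin_graph F x x'"
      using mono[of "fst z" "snd z" 0] by (simp add: poly_monom)
  qed
  show "(x, x') \<in> adjoin_graph F x x'"
    using mono[of 1 1 1] hom_graph_closed[OF F] by (simp add: poly_monom)
  show "hom_graph (adjoin_graph F x x')"
    unfolding hom_graph_def
  proof (intro conjI allI impI)
    show "(1, 1) \<in> adjoin_graph F x x'"
      using sub hom_graph_closed[OF F] by blast
  next
    fix y y' z z' assume "(y, y') \<in> adjoin_graph F x x'" "(z, z') \<in> adjoin_graph F x x'"
    then obtain p q r s where *: "y = poly p x" "y' = poly q x'" "poly_graph F p q"
      "z = poly r x" "z' = poly s x'" "poly_graph F r s"
      unfolding adjoin_graph_def by blast
    show "(y - z, y' - z') \<in> adjoin_graph F x x'"
      unfolding adjoin_graph_def using poly_graph_closed(1)[OF F *(3,6)] *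
      by (force simp flip: poly_diff)
    show "(y * z, y' * z') \<in> adjoin_graph F x x'"
      unfolding adjoin_graph_def using poly_graph_closed(2)[OF F *(3,6)] *
      by (force simp flip: poly_mult)
  next
    fix y assume "(0, y) \<in> adjoin_graph F x x'"
    then obtain p q where *: "poly p x = 0" "y = poly q x'" "poly_graph F p q"
      unfolding adjoin_graph_def by force
    then have "m' dvd q"
      using is_min_poly_dvd_graph[OF F m m'] by blast
    with root * show "y = 0" by (auto elim: dvdE)
  qed
qed

section \<open>Endomorphisms of an algebraically closed field over a subfield\<close>

definition endo_over :: "'a::field set \<Rightarrow> ('a \<Rightarrow> 'a) \<Rightarrow> bool" where
  "endo_over K \<sigma> \<longleftrightarrow> (\<forall>x y. \<sigma> (x + y) = \<sigma> x + \<sigma> y \<and> \<sigma> (x * y) = \<sigma> x * \<sigma> y) \<and>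
     \<sigma> 1 = 1 \<and> (\<forall>x\<in>K. \<sigma> x = x)"

text \<open>Zorn's lemma yields a maximal graph \<open>F\<close> containing \<open>G\<close>. Its
  domain is a field by algebraicity, so any \<open>x\<close> has a minimal polynomial over it; the
  image of that polynomial has a root \<open>x'\<close>, and maximality applied to
  \<open>adjoin_graph F x x'\<close> puts \<open>x\<close> into the domain.\<close>

lemma hom_graph_extends:
  fixes K :: "'a::alg_closed_field set"
  assumes K: "subfield K (ring_of_type_algebra :: 'a ring)" and alg: "algebraic_type K"
    and G: "hom_graph G" "Id_on K \<subseteq> G"
  shows "\<exists>\<sigma>. endo_over K \<sigma> \<and> (\<forall>(x, y)\<in>G. \<sigma> x = y)"
proof -
  define \<A> where "\<A> = {F. hom_graph F \<and> G \<subseteq> F}"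
  have "\<exists>F\<in>\<A>. \<forall>H\<in>\<A>. F \<subseteq> H \<longrightarrow> H = F"
  proof (rule subset_Zorn_nonempty)
    show "\<A> \<noteq> {}"
      using G by (auto simp: \<A>_def)
  next
    fix \<C> assume C: "\<C> \<noteq> {}" "subset.chain \<A> \<C>"
    have hg: "hom_graph H" "G \<subseteq> H" if "H \<in> \<C>" for H
      using C that unfolding subset_chain_def \<A>_def by auto
    \<comment> \<open>Two pairs from the union of a chain lie in a common member, which supplies the
      closure under both operations.\<close>
    have two: "\<exists>H\<in>\<C>. u \<in> H \<and> v \<in> H" if "u \<in> \<Union>\<C>" "v \<in> \<Union>\<C>" for u v
    proof -
      obtain U V where UV: "U \<in> \<C>" "u \<in> U" "V \<in> \<C>" "v \<in> V"
        using \<open>u \<in> \<Union>\<C>\<close> \<open>v \<in> \<Union>\<C>\<close> by blast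
      then have "U \<subseteq> V \<or> V \<subseteq> U"
        using C(2) unfolding subset_chain_def by blast
      with UV show ?thesis by blast
    qed
    have "hom_graph (\<Union>\<C>)"
      unfolding hom_graph_def
    proof (intro conjI allI impI)
      show "(1, 1) \<in> \<Union>\<C>"
        using C(1) hg hom_graph_closed(2) by blast
      show "(x - y, x' - y') \<in> \<Union>\<C>" "(x * y, x' * y') \<in> \<Union>\<C>"
        if "(x, x') \<in> \<Union>\<C>" "(y, y') \<in> \<Union>\<C>" for x x' y y'
        using two[OF that] hg hom_graph_closed(4,5) by (blast, blast)
      show "y = 0" if "(0, y) \<in> \<Union>\<C>" for y
        using that hg hom_graph_closed(6) by blast
    qed
    moreover have "G \<subseteq> \<Union>\<C>"
      using C(1) hg(2) by blast
    ultimately show "\<Union>\<C> \<in> \<A>"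
      by (simp add: \<A>_def)
  qed
  then obtain F where "F \<in> \<A>" and max': "\<And>H. H \<in> \<A> \<Longrightarrow> F \<subseteq> H \<Longrightarrow> H = F"
    by blast
  then have F: "hom_graph F" "G \<subseteq> F"
    by (auto simp: \<A>_def)
  then have max: "H = F" if "hom_graph H" "F \<subseteq> H" for H
    using that by (intro max') (auto simp: \<A>_def)
  have KF: "K \<subseteq> Domain F"
    using G F by blast
  have fD: "subfield (Domain F) (ring_of_type_algebra :: 'a ring)"
    by (rule subring_algebraic_imp_subfield[OF K alg subring_Domain[OF F(1)] KF])
  have total: "x \<in> Domain F" for x
  proof -
    obtain m where m: "is_min_poly (Domain F) x m"
      using is_min_poly_exists[OF fD algebraic_type_mono[OF alg KF]] by blast
    then obtain m' where m': "poly_graph F m m'"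
      using poly_graph_exists[OF F(1)] unfolding is_min_poly_def by blast
    have "degree m \<noteq> 0"
    proof
      assume "degree m = 0"
      then obtain c where "m = [:c:]"
        by (metis degree_eq_zeroE)
      with m show False by (auto simp: is_min_poly_def)
    qed
    \<comment> \<open>The leading coefficient 1 is sent to 1, so the image of \<open>m\<close> is
      not constant and has a root.\<close>
    moreover have "coeff m' (degree m) = 1"
      using m m' hom_graph_unique[OF F(1) _ hom_graph_closed(2)[OF F(1)]]
      by (auto simp: is_min_poly_def poly_graph_def) metis
    ultimately have "degree m' > 0"
      using le_degree[of m' "degree m"] by simp
    then obtain x' where "poly m' x' = 0"
      using alg_closed_imp_poly_has_root by blast
    note adj = adjoin_graph[OF F(1) m m' this]
    show ?thesis
      using max[OF adj(1,2)] adj(3) by auto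
  qed
  define \<sigma> where "\<sigma> x = (THE y. (x, y) \<in> F)" for x
  have \<sigma>: "\<sigma> x = y" if "(x, y) \<in> F" for x y
    unfolding \<sigma>_def using that hom_graph_unique[OF F(1)] by blast
  have \<sigma>F: "(x, \<sigma> x) \<in> F" for x
    using total[of x] \<sigma> by auto
  have "endo_over K \<sigma>"
    unfolding endo_over_def using G F(2)
    by (auto intro!: \<sigma> hom_graph_closed[OF F(1)] \<sigma>F)
  with \<sigma> F(2) show ?thesis by blast
qed

text \<open>
  A separable element outside \<open>K\<close> has a conjugate \<open>x' \<noteq> x\<close>; send \<open>x\<close> there and extend.
\<close>

lemma separable_moved:
  fixes K :: "'a::alg_closed_field set"
  assumes K: "subfield K (ring_of_type_algebra :: 'a ring)" and alg: "algebraic_type K"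
    and f: "\<And>i. coeff f i \<in> K" "poly f x = 0" "poly (pderiv f) x \<noteq> 0"
    and x: "x \<notin> K"
  shows "\<exists>\<sigma>. endo_over K \<sigma> \<and> \<sigma> x \<noteq> x"
proof -
  note K' = subring_type_closed[OF subfieldE(1)[OF K]]
  have hg: "hom_graph (Id_on K)"
    unfolding hom_graph_def using K' by auto
  have D: "Domain (Id_on K) = K" by auto
  have pg: "poly_graph (Id_on K) p p" if "\<And>i. coeff p i \<in> K" for p
    using that by (auto simp: poly_graph_def)
  obtain m where m: "is_min_poly K x m"
    using is_min_poly_exists[OF K alg] by blast
  then have mK: "\<And>i. coeff m i \<in> K" and mx: "poly m x = 0" and m1: "lead_coeff m = 1"
    by (auto simp: is_min_poly_def)
  have mD: "is_min_poly (Domain (Id_on K)) x m"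
    using m D by simp
  have "m dvd f"
    by (rule is_min_poly_dvd_graph[OF hg mD pg[OF mK] pg[OF f(1)] f(2)])
  \<comment> \<open>The conjugates of \<open>x\<close> other than \<open>x\<close> itself are sought
    among the roots of \<open>h\<close>. A constant \<open>h\<close> would make \<open>m\<close>
    linear and put \<open>x\<close> into \<open>K\<close>.\<close>
  obtain h where h: "m = [:- x, 1:] * h"
    using mx poly_eq_0_iff_dvd by (metis dvdE)
  have "degree h \<noteq> 0"
  proof
    assume "degree h = 0"
    then obtain c where "h = [:c:]"
      by (metis degree_eq_zeroE)
    with h m1 have "m = [:- x, 1:]" by (auto split: if_splits)
    with mK[of 0] K'(6)[of "- x"] x show False by simp
  qed
  then obtain x' where x': "poly h x' = 0"
    using alg_closed_imp_poly_has_root[of h] by auto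
  \<comment> \<open>A root of \<open>h\<close> at \<open>x\<close> would be a double root of
    \<open>m\<close>, hence of \<open>f\<close>, and the derivative of \<open>f\<close> would vanish
    there.\<close>
  have "x' \<noteq> x"
  proof
    assume "x' = x"
    then obtain g where "h = [:- x, 1:] * g"
      using x' poly_eq_0_iff_dvd by (metis dvdE)
    with h \<open>m dvd f\<close> obtain r where r: "f = [:- x, 1:] * ([:- x, 1:] * (g * r))"
      by (metis dvdE mult.assoc)
    show False
      using f(3) unfolding r by (simp only: pderiv_mult poly_add poly_mult) simp
  qed
  have "poly m x' = 0"
    using h x' by simp
  note adj = adjoin_graph[OF hg mD pg[OF mK] this]
  obtain \<sigma> where "endo_over K \<sigma>" "\<forall>(u, v)\<in>adjoin_graph (Id_on K) x x'. \<sigma> u = v"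
    using hom_graph_extends[OF K alg adj(1,2)] by blast
  with adj(3) \<open>x' \<noteq> x\<close> show ?thesis by auto
qed

lemma endo_over_simps:
  assumes "endo_over K \<sigma>"
  shows "\<sigma> (x + y) = \<sigma> x + \<sigma> y" "\<sigma> (x * y) = \<sigma> x * \<sigma> y" "\<sigma> 1 = 1" "\<sigma> 0 = 0"
    "\<sigma> (- x) = - \<sigma> x" "\<sigma> (x - y) = \<sigma> x - \<sigma> y" "\<sigma> (inverse x) = inverse (\<sigma> x)"
    "\<sigma> x = \<sigma> y \<longleftrightarrow> x = y"
proof -
  show add: "\<sigma> (x + y) = \<sigma> x + \<sigma> y" for x y
    using assms by (simp add: endo_over_def)
  show mult: "\<sigma> (x * y) = \<sigma> x * \<sigma> y" for x y
    using assms by (simp add: endo_over_def)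
  show one: "\<sigma> 1 = 1"
    using assms by (simp add: endo_over_def)
  show zero: "\<sigma> 0 = 0"
    using add[of 0 0] by (metis add_cancel_right_right add_0)
  show minus: "\<sigma> (- x) = - \<sigma> x" for x
    using add[of x "- x"] zero by (simp add: eq_neg_iff_add_eq_0 add.commute)
  show diff: "\<sigma> (x - y) = \<sigma> x - \<sigma> y" for x y
    using add[of x "- y"] minus[of y] by simp
  show inv: "\<sigma> (inverse x) = inverse (\<sigma> x)" for x
  proof (cases "x = 0")
    case False
    then show ?thesis
      using mult[of x "inverse x"] one by (intro inverse_unique[symmetric]) simp
  qed (simp add: zero)
  have ker: "x = 0" if "\<sigma> x = 0" for x
    using mult[of x "inverse x"] one that by (cases "x = 0") auto
  show "\<sigma> x = \<sigma> y \<longleftrightarrow> x = y"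
    using ker[of "x - y"] diff[of x y] by auto
qed

lemma endo_over_poly:
  assumes \<sigma>: "endo_over K \<sigma>" and "\<And>i. coeff p i \<in> K"
  shows "\<sigma> (poly p x) = poly p (\<sigma> x)"
  using assms(2)
proof (induction p)
  case (pCons a p)
  have "\<And>i. coeff p i \<in> K" "a \<in> K"
    using pCons.prems by (metis coeff_pCons_Suc, metis coeff_pCons_0)
  with pCons.IH show ?case
    using \<sigma> by (simp add: endo_over_simps[OF \<sigma>]) (simp add: endo_over_def)
qed (simp add: endo_over_simps[OF \<sigma>])

lemma endo_over_mono: "endo_over K \<sigma> \<Longrightarrow> L \<subseteq> K \<Longrightarrow> endo_over L \<sigma>"
  by (auto simp: endo_over_def)

section \<open>Rank one Drinfeld modules\<close>

lemma of_A_simps [simp]: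
  "of_A 0 = 0" "of_A (a + b) = of_A a + of_A b" "of_A (a * b) = of_A a * of_A b"
  "of_A a = 0 \<longleftrightarrow> a = 0"
  by (simp_all add: of_A_def)

lemma of_A_in_base_field: "of_A a \<in> base_field"
  by (simp add: of_A_def base_field_def)

text \<open>Translation by 1 permutes the finite field, so the sum of all its elements equals itself
  plus \<open>CARD('f)\<close>. It follows that \<open>CARD('f)\<close>-th powers of polynomials
  have derivative 0.\<close>

lemma of_nat_card_kbar: "of_nat CARD('f) = (0 :: 'f::{finite,field} kbar)"
proof -
  have "bij (\<lambda>x :: 'f. x + 1)"
    by (rule bij_betw_byWitness[where f' = "\<lambda>x. x - 1"]) auto
  then have "(\<Sum>x\<in>UNIV. x + 1) = (\<Sum>x\<in>(UNIV :: 'f set). x)"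
    by (rule sum.reindex_bij_betw)
  then have "of_nat CARD('f) = (0 :: 'f)"
    by (simp add: sum.distrib)
  moreover have "of_nat n = of_A (of_nat n :: 'f poly)" for n
    by (induction n) (simp_all add: of_A_def)
  ultimately show ?thesis by (simp add: of_nat_poly)
qed

lemma algebraic_base_field: "algebraic_type (base_field :: 'f::field kbar set)"
  unfolding algebraic_type_def
proof
  fix x :: "'f kbar"
  obtain p :: "'f poly fract poly" where p: "p \<noteq> 0" "poly (map_poly to_ac p) x = 0"
    by (rule alg_closure_algebraic)
  then have "map_poly to_ac p \<noteq> 0 \<and> (\<forall>i. coeff (map_poly to_ac p) i \<in> base_field) \<and>
      poly (map_poly to_ac p) x = 0"
    by (auto simp: base_field_def coeff_map_poly map_poly_eq_0_iff)
  then show "\<exists>p. p \<noteq> 0 \<and> (\<forall>i. coeff p i \<in> base_field) \<and> poly p x = 0" ..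
qed

section \<open>Adjunction inside the algebraic closure\<close>

lemma subfield_adjoin: "subfield (adjoin K S) (kbar_ring :: 'f::field kbar ring)"
proof -
  interpret field "kbar_ring :: 'f kbar ring" by (rule field_from_type_algebra)
  show ?thesis
    unfolding adjoin_def by (rule generate_field_is_subfield) simp
qed

lemma adjoin_incl: "K \<subseteq> adjoin K S" "S \<subseteq> adjoin K S"
  by (auto simp: adjoin_def intro: generate_field.incl)

lemma adjoin_least:
  assumes "subfield M (kbar_ring :: 'f::field kbar ring)" "K \<subseteq> M" "S \<subseteq> M"
  shows "adjoin K S \<subseteq> M"
proof -
  interpret field "kbar_ring :: 'f kbar ring" by (rule field_from_type_algebra)
  show ?thesis
    unfolding adjoin_def using assms by (intro generate_field_min_subfield1) auto
qed

lemma coprime_bezout: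
  fixes l s :: "'f::field_gcd poly"
  assumes "Factorial_Ring.irreducible l" "\<not> l dvd s"
  obtains t u where "t * s + u * l = 1"
proof -
  have "coprime l s"
    using assms by (simp add: prime_elem_imp_coprime irreducible_imp_prime_elem_gcd)
  then have "gcd s l = 1"
    by (simp add: gcd.commute)
  then show ?thesis
    using that bezout_coefficients_fst_snd[of s l] by simp
qed

section \<open>The action of \<open>A\<close> by separable polynomials over \<open>L\<close>\<close>

locale drinfeld_prime =
  fixes L :: "'f::{finite,field_gcd} kbar set" and c :: "'f kbar"
    and \<phi> :: "'f poly \<Rightarrow> 'f kbar \<Rightarrow> 'f kbar" and l :: "'f poly"
  assumes subfield_L: "subfield L (kbar_ring :: 'f kbar ring)" and base_L: "base_field \<subseteq> L"
    and drinfeld: "drinfeld_rank_one L c \<phi>"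
    and irred: "Factorial_Ring.irreducible l"
begin

sublocale Modules.module \<phi>
  using drinfeld by (simp add: drinfeld_rank_one_def)

text \<open>Horner's scheme: \<open>pCons z b\<close> is \<open>z + T * b\<close>, and \<phi> turns
  the product into a composition.\<close>

lemma action_pCons:
  "\<phi> (pCons z b) x = of_A [:z:] * x + (of_A [:0, 1:] * \<phi> b x + c * \<phi> b x ^ CARD('f))"
proof -
  have "pCons z b = [:z:] + [:0, 1:] * b" by simp
  then have "\<phi> (pCons z b) x = \<phi> [:z:] x + \<phi> [:0, 1:] (\<phi> b x)"
    by (metis scale_left_distrib scale_scale)
  also have "\<phi> [:z:] x = of_A [:z:] * x"
    using drinfeld by (simp add: drinfeld_rank_one_def)
  also have "\<phi> [:0, 1:] (\<phi> b x) = of_A [:0, 1:] * \<phi> b x + c * \<phi> b x ^ CARD('f)"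
    using drinfeld unfolding drinfeld_rank_one_def by blast
  finally show ?thesis .
qed

text \<open>In each Horner step the \<open>CARD('f)\<close>-th power contributes nothing to the
  derivative and multiplies the degree bound by \<open>CARD('f)\<close>. Coefficients in
  \<open>L\<close> make endomorphisms over \<open>L\<close> commute with \<phi>, the derivative
  gives separability, and the degree bounds the number of torsion points.\<close>

lemma action_poly:
  "\<exists>P. (\<forall>x. \<phi> a x = poly P x) \<and> (\<forall>i. coeff P i \<in> L) \<and> pderiv P = [:of_A a:] \<and>
     degree P \<le> CARD('f) ^ degree a"
proof (induction a)
  case 0
  show ?case
    using subring_type_closed(1)[OF subfieldE(1)[OF subfield_L]] by (intro exI[of _ 0]) simp
next
  case (pCons z b)
  note L = subring_type_closed[OF subfieldE(1)[OF subfield_L]]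
  let ?q = "CARD('f)"
  have AL: "of_A a \<in> L" for a
    using of_A_in_base_field base_L by blast
  have lin: "coeff [:0, of_A [:z:]:] i \<in> L" for i
    by (auto simp: coeff_pCons AL L split: nat.split)
  show ?case
  \<comment> \<open>For \<open>b = 0\<close> the degree of \<open>pCons z b\<close> does not exceed
    that of \<open>b\<close>, so the bound stays at 1 and is met by a linear polynomial
    directly.\<close>
  proof (cases "b = 0")
    case True
    have "\<phi> [:z:] x = of_A [:z:] * x" for x
      using drinfeld by (simp add: drinfeld_rank_one_def)
    with True lin show ?thesis
      by (intro exI[of _ "[:0, of_A [:z:]:]"]) (auto simp: pderiv_pCons)
  next
    case False
    obtain P where P: "\<forall>x. \<phi> b x = poly P x" "\<forall>i. coeff P i \<in> L" "pderiv P = [:of_A b:]"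
      "degree P \<le> ?q ^ degree b"
      using pCons.IH by blast
    define Q where "Q = [:0, of_A [:z:]:] + (smult (of_A [:0, 1:]) P + smult c (P ^ ?q))"
    have "\<forall>x. \<phi> (pCons z b) x = poly Q x"
      unfolding action_pCons using P(1) by (simp add: Q_def algebra_simps)
    moreover have "coeff Q i \<in> L" for i
    proof -
      have "coeff (P ^ ?q) i \<in> L"
        using P(2) by (intro subring_type_coeff_power[OF subfieldE(1)[OF subfield_L]]) auto
      moreover have "c \<in> L"
        using drinfeld by (simp add: drinfeld_rank_one_def)
      ultimately show ?thesis
        unfolding Q_def coeff_add coeff_smult using P(2) by (intro L lin AL) auto
    qed
    moreover have "pderiv Q = [:of_A (pCons z b):]"
    proof -
      have "pderiv (P ^ ?q) = 0"
        by (simp add: pderiv_power of_nat_card_kbar)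
      then have "pderiv Q = [:of_A [:z:] + of_A [:0, 1:] * of_A b:]"
        by (simp add: Q_def pderiv_add pderiv_smult P(3) pderiv_pCons)
      also have "of_A [:z:] + of_A [:0, 1:] * of_A b = of_A ([:z:] + [:0, 1:] * b)"
        by (simp only: of_A_simps)
      finally show ?thesis by simp
    qed
    moreover have "degree Q \<le> ?q ^ degree (pCons z b)"
    proof -
      have q: "?q ^ degree b \<le> ?q ^ degree (pCons z b)" "1 \<le> ?q ^ degree (pCons z b)"
        using False by (auto simp: Suc_le_eq)
      have "degree (P ^ ?q) \<le> ?q ^ degree (pCons z b)"
        using degree_power_le[of P ?q] False order.trans[OF _ mult_le_mono2[OF P(4), of ?q]]
        by (simp add: mult.commute)
      moreover have "degree [:0, of_A [:z:]:] \<le> 1"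
        by simp
      ultimately show ?thesis
        unfolding Q_def using q P(4)
        by (intro degree_add_le order.trans[OF degree_smult_le]) auto
    qed
    ultimately show ?thesis by blast
  qed
qed

lemma endo_action: "endo_over L \<sigma> \<Longrightarrow> \<sigma> (\<phi> a x) = \<phi> a (\<sigma> x)"
  using action_poly[of a] endo_over_poly by metis

lemma l_nz: "l \<noteq> 0"
  using irred by auto

text \<open>The polynomial of \<open>\<phi> l\<close> has nonzero derivative, so it is not constant
  and takes every value.\<close>

lemma division_exists: "\<exists>x. \<phi> l x = a"
proof -
  obtain P where P: "\<forall>x. \<phi> l x = poly P x" "pderiv P = [:of_A l:]"
    using action_poly by blast
  have "degree P \<noteq> 0"
  proof
    assume "degree P = 0"
    then obtain k where "P = [:k:]"
      by (metis degree_eq_zeroE)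
    with P(2) l_nz show False by (simp add: pderiv_pCons)
  qed
  then have "degree (P - [:a:]) > 0"
    using degree_add_eq_left[of "- [:a:]" P] by (simp only: diff_conv_add_uminus) simp
  then obtain x where "poly (P - [:a:]) x = 0"
    using alg_closed_imp_poly_has_root by blast
  with P(1) show ?thesis by auto
qed

text \<open>Galois descent for division points: \<open>x\<close> is a root of the polynomial of
  \<open>\<phi> l\<close> minus the constant \<open>\<phi> l x\<close>. Its coefficients lie in
  \<open>K\<close> and its derivative is the nonzero constant \<open>l\<close>, so \<open>x\<close>
  is separable over \<open>K\<close> and would be moved if it lay outside.\<close>

lemma fixed_imp_in:
  assumes K: "subfield K (kbar_ring :: 'f kbar ring)" "L \<subseteq> K" and x: "\<phi> l x \<in> K"
    and fixed: "\<And>\<sigma>. endo_over K \<sigma> \<Longrightarrow> \<sigma> x = x"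
  shows "x \<in> K"
proof (rule ccontr)
  assume "x \<notin> K"
  obtain P where P: "\<forall>x. \<phi> l x = poly P x" "\<forall>i. coeff P i \<in> L" "pderiv P = [:of_A l:]"
    using action_poly by blast
  note K' = subring_type_closed[OF subfieldE(1)[OF K(1)]]
  define f where "f = P - [:\<phi> l x:]"
  have "coeff f i \<in> K" for i
  proof -
    have "coeff [:\<phi> l x:] i \<in> K"
      using x by (auto simp: coeff_pCons K' split: nat.split)
    then show ?thesis
      unfolding f_def coeff_diff using P(2) K(2) by (intro K') auto
  qed
  moreover have "poly f x = 0"
    using P(1) by (simp add: f_def)
  moreover have "poly (pderiv f) x \<noteq> 0"
    using l_nz by (simp add: f_def pderiv_diff P(3) pderiv_pCons)
  moreover have "algebraic_type K"
    using algebraic_type_mono[OF algebraic_base_field] base_L K(2) by blast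
  ultimately show False
    using separable_moved[OF K(1)] \<open>x \<notin> K\<close> fixed by metis
qed

section \<open>The torsion as a one-dimensional space over \<open>A / l\<close>\<close>

lemma torsion_closed:
  shows "x \<in> torsion \<phi> l \<Longrightarrow> \<phi> a x \<in> torsion \<phi> l"
    and "endo_over L \<sigma> \<Longrightarrow> x \<in> torsion \<phi> l \<Longrightarrow> \<sigma> x \<in> torsion \<phi> l"
proof -
  show "\<phi> a x \<in> torsion \<phi> l" if "x \<in> torsion \<phi> l"
    using that scale_left_commute[of l a x] by (simp add: torsion_def)
  show "\<sigma> x \<in> torsion \<phi> l" if "endo_over L \<sigma>" "x \<in> torsion \<phi> l"
    using that endo_action[OF that(1), of l x]
    by (simp add: torsion_def endo_over_simps[OF that(1)])
qed

text \<open>By Bezout \<open>s\<close> is invertible modulo \<open>l\<close>, so it acts injectively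
  on the torsion.\<close>

lemma torsion_annihilated:
  assumes "x \<in> torsion \<phi> l" "\<phi> s x = 0" "\<not> l dvd s"
  shows "x = 0"
proof -
  obtain t u where tu: "t * s + u * l = 1"
    using coprime_bezout[OF irred assms(3)] .
  have "x = \<phi> (t * s + u * l) x"
    by (simp add: tu)
  also have "\<dots> = \<phi> t (\<phi> s x) + \<phi> u (\<phi> l x)"
    by (simp only: scale_left_distrib scale_scale)
  finally show ?thesis
    using assms by (simp add: torsion_def del: scale_scale)
qed

text \<open>
  Rank one: \<open>\<phi> l\<close> has degree \<open>q ^ degree l\<close>, so a nonzero torsion point generates the torsion.
\<close>

lemma torsion_cyclic:
  assumes y: "y \<in> torsion \<phi> l" "y \<noteq> 0" and x: "x \<in> torsion \<phi> l"
  shows "\<exists>b. x = \<phi> b y"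
proof -
  \<comment> \<open>Coefficient lists of length \<open>degree l\<close> represent the residues
    modulo \<open>l\<close>, and there are \<open>CARD('f) ^ degree l\<close> of them.\<close>
  define S where "S = {xs :: 'f list. set xs \<subseteq> UNIV \<and> length xs = degree l}"
  define f where "f xs = \<phi> (Poly xs) y" for xs
  obtain P where P: "\<forall>x. \<phi> l x = poly P x" "pderiv P = [:of_A l:]"
    "degree P \<le> CARD('f) ^ degree l"
    using action_poly by blast
  have "P \<noteq> 0"
    using P(2) l_nz by auto
  have tors: "torsion \<phi> l = {x. poly P x = 0}"
    using P(1) by (simp add: torsion_def)
  have fin: "finite (torsion \<phi> l)"
    using \<open>P \<noteq> 0\<close> poly_roots_finite tors by metis
  have le: "card (torsion \<phi> l) \<le> CARD('f) ^ degree l"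
    using card_poly_roots_bound[OF \<open>P \<noteq> 0\<close>] P(3) tors by simp
  have inj: "inj_on f S"
  proof
    fix xs ys assume S: "xs \<in> S" "ys \<in> S" and eq: "f xs = f ys"
    have "\<phi> (Poly xs - Poly ys) y = 0"
      using eq by (simp add: f_def scale_left_diff_distrib)
    then have dvd: "l dvd Poly xs - Poly ys"
      using torsion_annihilated y by blast
    \<comment> \<open>A nonzero multiple of \<open>l\<close> has degree at least
      \<open>degree l\<close>, but the coefficients of this difference vanish from there on.\<close>
    have "Poly xs = Poly ys"
    proof (rule ccontr)
      assume ne: "Poly xs \<noteq> Poly ys"
      then have "degree l \<le> degree (Poly xs - Poly ys)"
        using dvd by (intro dvd_imp_degree_le) auto
      moreover have "coeff (Poly xs - Poly ys) i = 0" if "i \<ge> degree l" for i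
        using S that by (simp add: S_def nth_default_def)
      ultimately show False
        using ne by (metis eq_iff_diff_eq_0 leading_coeff_0_iff)
    qed
    then have "nth_default 0 xs i = nth_default 0 ys i" for i
      by (metis coeff_Poly_eq)
    with S show "xs = ys"
      by (intro nth_equalityI) (auto simp: S_def nth_default_def, metis)
  qed
  have "f ` S \<subseteq> torsion \<phi> l"
    using torsion_closed(1)[OF y(1)] by (auto simp: f_def)
  moreover have "card (f ` S) = CARD('f) ^ degree l"
    using card_image[OF inj] card_lists_length_eq[of "UNIV :: 'f set"] by (simp add: S_def)
  \<comment> \<open>The multiples of \<open>y\<close> are already as many as the roots that the
    degree allows.\<close>
  ultimately have "f ` S = torsion \<phi> l"
    using fin le by (intro card_seteq) auto
  with x show ?thesis
    by (auto simp: f_def)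
qed

lemma torsion_field_trivial:
  assumes "\<And>x. x \<in> torsion \<phi> l \<Longrightarrow> x \<in> L"
  shows "torsion_field L \<phi> l \<subseteq> L"
  unfolding torsion_field_def using assms subfield_L by (intro adjoin_least) auto

text \<open>
  Sah's argument: some \<open>\<sigma>\<close> acts on the torsion as a scalar \<open>s \<noteq> 1\<close>, so \<open>\<alpha>\<close> can be corrected by
  a torsion point to be fixed by \<open>\<sigma>\<close>; as the Galois group of the torsion field is abelian, any
  other conjugate differs from it by a torsion point fixed by \<open>\<sigma>\<close>, that is, by \<open>0\<close>.
\<close>

lemma division_descends:
  assumes a: "a \<in> L" and \<alpha>: "\<alpha> \<in> torsion_field L \<phi> l" "\<phi> l \<alpha> = a"
  shows "\<exists>\<beta>\<in>L. \<phi> l \<beta> = a"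
proof (cases "\<forall>\<sigma> x. endo_over L \<sigma> \<longrightarrow> x \<in> torsion \<phi> l \<longrightarrow> \<sigma> x = x")
  \<comment> \<open>With all torsion points fixed, the torsion lies in \<open>L\<close>, so the
    torsion field is \<open>L\<close> and \<alpha> itself serves.\<close>
  case True
  have "x \<in> L" if "x \<in> torsion \<phi> l" for x
  proof (rule fixed_imp_in[OF subfield_L order.refl])
    show "\<phi> l x \<in> L"
      using that subring_type_closed(1)[OF subfieldE(1)[OF subfield_L]] by (simp add: torsion_def)
  qed (use True that in blast)
  with torsion_field_trivial \<alpha> show ?thesis by blast
next
  case False
  then obtain \<sigma> y where \<sigma>: "endo_over L \<sigma>" and y: "y \<in> torsion \<phi> l" "\<sigma> y \<noteq> y"
    by blast
  then have y0: "y \<noteq> 0"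
    using endo_over_simps(4)[OF \<sigma>] by auto
  \<comment> \<open>The generator \<open>y\<close> goes to some \<open>\<phi> s y\<close>; every
    torsion point is a multiple of \<open>y\<close>, and \<tau> commutes with \<phi>, so the same
    \<open>s\<close> works throughout.\<close>
  have scalar: "\<exists>s. \<forall>x\<in>torsion \<phi> l. \<tau> x = \<phi> s x" if \<tau>: "endo_over L \<tau>" for \<tau>
  proof -
    obtain s where s: "\<tau> y = \<phi> s y"
      using torsion_cyclic[OF y(1) y0 torsion_closed(2)[OF \<tau> y(1)]] by blast
    have "\<tau> x = \<phi> s x" if x: "x \<in> torsion \<phi> l" for x
    proof -
      obtain b where b: "x = \<phi> b y"
        using torsion_cyclic[OF y(1) y0 x] by blast
      then have "\<tau> x = \<phi> b (\<phi> s y)"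
        using endo_action[OF \<tau>] s by simp
      then show ?thesis
        unfolding b by (simp add: mult.commute)
    qed
    then show ?thesis by blast
  qed
  obtain s where s: "\<And>x. x \<in> torsion \<phi> l \<Longrightarrow> \<sigma> x = \<phi> s x"
    using scalar[OF \<sigma>] by blast
  have s1: "\<phi> (s - 1) x = \<sigma> x - x" if "x \<in> torsion \<phi> l" for x
    using s[OF that] by (simp add: scale_left_diff_distrib)
  have ndvd: "\<not> l dvd s - 1"
  proof
    assume "l dvd s - 1"
    then obtain r where "s - 1 = r * l"
      by (metis dvdE mult.commute)
    then have "\<phi> (s - 1) y = \<phi> r (\<phi> l y)" by simp
    with y s1 show False by (simp add: torsion_def)
  qed
  obtain t u where tu: "t * (s - 1) + u * l = 1"
    using coprime_bezout[OF irred ndvd] .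
  define d where "d = \<sigma> \<alpha> - \<alpha>"
  have \<sigma>a: "\<sigma> a = a"
    using \<sigma> a by (simp add: endo_over_def)
  have d: "d \<in> torsion \<phi> l"
    using endo_action[OF \<sigma>, of l \<alpha>] \<alpha>(2) \<sigma>a
    by (simp add: d_def torsion_def scale_right_diff_distrib)
  \<comment> \<open>As \<open>t\<close> inverts \<open>s - 1\<close> modulo \<open>l\<close>, the
    torsion point \<open>\<phi> t d\<close> is moved by \<sigma> by exactly \<open>d\<close>, the
    amount by which \<alpha> is moved.\<close>
  define \<beta> where "\<beta> = \<alpha> - \<phi> t d"
  have td: "\<phi> t d \<in> torsion \<phi> l"
    by (rule torsion_closed(1)[OF d])
  have \<beta>a: "\<phi> l \<beta> = a"
    using td \<alpha>(2) by (simp add: \<beta>_def torsion_def scale_right_diff_distrib)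
  note sf = subfield_adjoin[of L "torsion \<phi> l", folded torsion_field_def]
  note tf = subring_type_closed[OF subfieldE(1)[OF sf]]
  have tors_tf: "torsion \<phi> l \<subseteq> torsion_field L \<phi> l"
    by (simp add: torsion_field_def adjoin_incl)
  have \<beta>tf: "\<beta> \<in> torsion_field L \<phi> l"
    unfolding \<beta>_def using tors_tf td by (intro tf \<alpha>) auto
  have \<sigma>\<beta>: "\<sigma> \<beta> = \<beta>"
  proof -
    have "\<phi> (u * l) d = 0"
      using d scale_scale[of u l d] by (simp add: torsion_def)
    then have "\<phi> (s - 1) (\<phi> t d) = \<phi> (t * (s - 1) + u * l) d"
      by (simp add: scale_left_distrib mult.commute)
    then have "\<sigma> (\<phi> t d) - \<phi> t d = d"
      using s1[OF td] by (simp add: tu)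
    then show ?thesis
      by (simp add: \<beta>_def endo_over_simps[OF \<sigma>] d_def algebra_simps)
  qed
  have "\<tau> \<beta> = \<beta>" if \<tau>: "endo_over L \<tau>" for \<tau>
  proof -
    obtain r where r: "\<And>x. x \<in> torsion \<phi> l \<Longrightarrow> \<tau> x = \<phi> r x"
      using scalar[OF \<tau>] by blast
    \<comment> \<open>The points where \<sigma> and \<tau> commute form a subfield. It contains
      \<open>L\<close>, which both fix, and the torsion, on which both are scalars.\<close>
    let ?C = "{x. \<sigma> (\<tau> x) = \<tau> (\<sigma> x)}"
    have "subfield ?C (kbar_ring :: 'f kbar ring)"
      by (simp add: subfield_type_iff subring_type_iff endo_over_simps[OF \<sigma>] endo_over_simps[OF \<tau>])
    moreover have "L \<subseteq> ?C"
      using \<sigma> \<tau> by (auto simp: endo_over_def)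
    moreover have "torsion \<phi> l \<subseteq> ?C"
      using r s torsion_closed(1) by (auto simp: mult.commute)
    ultimately have "torsion_field L \<phi> l \<subseteq> ?C"
      unfolding torsion_field_def by (rule adjoin_least)
    with \<beta>tf have comm: "\<sigma> (\<tau> \<beta>) = \<tau> \<beta>"
      using \<sigma>\<beta> by auto
    define e where "e = \<tau> \<beta> - \<beta>"
    have "\<tau> a = a"
      using \<tau> a by (simp add: endo_over_def)
    then have e: "e \<in> torsion \<phi> l"
      using endo_action[OF \<tau>, of l \<beta>] \<beta>a by (simp add: e_def torsion_def scale_right_diff_distrib)
    have "\<sigma> e = e"
      using comm \<sigma>\<beta> by (simp add: e_def endo_over_simps[OF \<sigma>])
    then have "e = 0"
      using s1[OF e] torsion_annihilated[OF e _ ndvd] by simp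
    then show ?thesis by (simp add: e_def)
  qed
  then have "\<beta> \<in> L"
    using fixed_imp_in[OF subfield_L order.refl] a \<beta>a by blast
  with \<beta>a show ?thesis by blast
qed

section \<open>From the Kummer kernel to division points in \<open>L\<close>\<close>

text \<open>Each division point is moved by a torsion point, so \<tau> maps the Kummer field into
  itself. Surjectivity is not part of \<open>endo_over\<close> and is checked on generators.\<close>

lemma restrict_in_kummer_group:
  assumes \<Gamma>: "\<Gamma> \<subseteq> L" and \<tau>: "endo_over (torsion_field L \<phi> l) \<tau>"
  shows "restrict \<tau> (kummer_field L \<phi> l \<Gamma>) \<in> kummer_group L \<phi> l \<Gamma>"
proof -
  define M where "M = kummer_field L \<phi> l \<Gamma>"
  note simps = endo_over_simps[OF \<tau>]
  have Ltf: "L \<subseteq> torsion_field L \<phi> l" "torsion \<phi> l \<subseteq> torsion_field L \<phi> l"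
    by (simp_all add: torsion_field_def adjoin_incl)
  note \<tau>L = endo_over_mono[OF \<tau> Ltf(1)]
  have fixed: "\<tau> x = x" if "x \<in> L \<union> torsion \<phi> l" for x
    using \<tau> that Ltf by (auto simp: endo_over_def)
  have sM: "subfield M (kbar_ring :: 'f kbar ring)"
    unfolding M_def kummer_field_def by (rule subfield_adjoin)
  have sub: "L \<subseteq> M" "torsion \<phi> l \<subseteq> M" "division_points \<phi> l \<Gamma> \<subseteq> M"
    unfolding M_def kummer_field_def
    using adjoin_incl[where K = L and S = "torsion \<phi> l \<union> division_points \<phi> l \<Gamma>"]
    by blast+
  have div: "\<tau> x - x \<in> torsion \<phi> l" if "x \<in> division_points \<phi> l \<Gamma>" for x
    using that \<Gamma> endo_action[OF \<tau>L, of l x] fixed[of "\<phi> l x"]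
    by (auto simp: division_points_def torsion_def scale_right_diff_distrib)
  have "M \<subseteq> {x. \<tau> x \<in> M}"
    unfolding M_def kummer_field_def
  proof (rule adjoin_least, fold kummer_field_def, fold M_def)
    show "subfield {x. \<tau> x \<in> M} (kbar_ring :: 'f kbar ring)"
      using sM by (simp add: subfield_type_iff subring_type_iff simps)
    show "L \<subseteq> {x. \<tau> x \<in> M}"
      using fixed sub by auto
    have "\<tau> x \<in> M" if "x \<in> division_points \<phi> l \<Gamma>" for x
      using subring_type_closed(3)[OF subfieldE(1)[OF sM], of "\<tau> x - x" x] div[OF that] that sub
      by auto
    then show "torsion \<phi> l \<union> division_points \<phi> l \<Gamma> \<subseteq> {x. \<tau> x \<in> M}"
      using fixed sub by auto
  qed
  moreover have "M \<subseteq> \<tau> ` M"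
    unfolding M_def kummer_field_def
  proof (rule adjoin_least, fold kummer_field_def, fold M_def)
    show "subfield (\<tau> ` M) (kbar_ring :: 'f kbar ring)"
      using sM by (auto simp: subfield_type_iff subring_type_iff simp flip: simps(2,6,7))
        (metis imageI simps(3))
    have fixM: "x \<in> \<tau> ` M" if "x \<in> L \<union> torsion \<phi> l" for x
      using fixed[OF that] that sub by (auto intro!: image_eqI[of x \<tau> x])
    then show "L \<subseteq> \<tau> ` M"
      by blast
    have "x \<in> \<tau> ` M" if x: "x \<in> division_points \<phi> l \<Gamma>" for x
    proof -
      have "\<tau> (\<tau> x - x) = \<tau> x - x"
        using fixed div[OF x] by blast
      \<comment> \<open>Because \<tau> fixes the torsion point \<open>\<tau> x - x\<close>,
        subtracting it from \<open>x\<close> gives a preimage of \<open>x\<close>.\<close>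
      then have "\<tau> (x - (\<tau> x - x)) = x"
        by (simp only: simps(6)[of x]) simp
      moreover have "x - (\<tau> x - x) \<in> M"
        using subring_type_closed(4)[OF subfieldE(1)[OF sM], of x "\<tau> x - x"] div[OF x] x sub
        by auto
      ultimately show ?thesis by (metis imageI)
    qed
    with fixM show "torsion \<phi> l \<union> division_points \<phi> l \<Gamma> \<subseteq> \<tau> ` M"
      by blast
  qed
  ultimately have "bij_betw (restrict \<tau> M) M M" "restrict \<tau> M \<in> M \<rightarrow> M"
    by (auto simp: bij_betw_def inj_on_def simps)
  moreover have "torsion_field L \<phi> l \<subseteq> M"
    unfolding torsion_field_def using sM sub by (intro adjoin_least) auto
  moreover have "restrict \<tau> M \<in> ring_hom (kbar_ring\<lparr>carrier := M\<rparr>) (kbar_ring\<lparr>carrier := M\<rparr>)"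
    using calculation(2) subring_type_closed[OF subfieldE(1)[OF sM]]
    by (auto simp: ring_hom_def simps)
  ultimately have "restrict \<tau> M \<in> Gal M (torsion_field L \<phi> l)"
    using \<tau> by (auto simp: Gal_def ring_iso_def endo_over_def)
  then show ?thesis
    by (simp add: kummer_group_def M_def)
qed

lemma kummer_kernel_division:
  assumes \<Gamma>: "\<Gamma> \<subseteq> L" and a: "a \<in> kummer_kernel L \<phi> l \<Gamma>"
  shows "a \<in> \<Gamma>" "\<exists>\<beta>\<in>L. \<phi> l \<beta> = a"
proof -
  show a\<Gamma>: "a \<in> \<Gamma>"
    using a by (simp add: kummer_kernel_def a_kernel_def' submodule_via_def)
  \<comment> \<open>The same choice as in \<open>kummer_map\<close>, so that membership in the
    kernel says that the Kummer group fixes this \<alpha>.\<close>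
  define \<alpha> where "\<alpha> = (SOME \<alpha>. \<phi> l \<alpha> = a)"
  have \<alpha>: "\<phi> l \<alpha> = a"
    unfolding \<alpha>_def by (rule someI_ex) (rule division_exists)
  have ker: "kummer_map L \<phi> l \<Gamma> a = (\<lambda>\<sigma>\<in>kummer_group L \<phi> l \<Gamma>. 0)"
    using a by (simp add: kummer_kernel_def a_kernel_def' submodule_via_def Hom_module_def
        kummer_module_def)
  have fixed: "\<sigma> \<alpha> = \<alpha>" if "\<sigma> \<in> kummer_group L \<phi> l \<Gamma>" for \<sigma>
    using fun_cong[OF ker, of \<sigma>] that by (simp add: kummer_map_def Let_def flip: \<alpha>_def)
  have \<alpha>M: "\<alpha> \<in> kummer_field L \<phi> l \<Gamma>"
    unfolding kummer_field_def using \<alpha> a\<Gamma>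
    by (intro subsetD[OF adjoin_incl(2)]) (simp add: division_points_def)
  have Ltf: "L \<subseteq> torsion_field L \<phi> l"
    by (simp add: torsion_field_def adjoin_incl)
  have "\<alpha> \<in> torsion_field L \<phi> l"
  proof (rule fixed_imp_in)
    show "subfield (torsion_field L \<phi> l) (kbar_ring :: 'f kbar ring)"
      unfolding torsion_field_def by (rule subfield_adjoin)
    show "\<tau> \<alpha> = \<alpha>" if "endo_over (torsion_field L \<phi> l) \<tau>" for \<tau>
      \<comment> \<open>The group acts only on the Kummer field; every endomorphism over the torsion
        field restricts to one of its elements, and \<alpha> lies in that field.\<close>
      using fixed[OF restrict_in_kummer_group[OF \<Gamma> that]] \<alpha>M by simp
  qed (use Ltf \<alpha> a\<Gamma> \<Gamma> in auto)
  with division_descends \<alpha> a\<Gamma> \<Gamma> show "\<exists>\<beta>\<in>L. \<phi> l \<beta> = a" by blast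
qed

text \<open>Both arguments of the gcd carry \<beta> into \<Gamma>, and the gcd is a combination of
  them by Bezout.\<close>

lemma e_l_division:
  assumes \<Gamma>: "subspace \<Gamma>" and l: "lead_coeff l = 1" and \<beta>: "\<beta> \<in> L" "\<phi> l \<beta> \<in> \<Gamma>"
  shows "\<phi> (e_l L \<phi> l \<Gamma>) \<beta> \<in> \<Gamma>"
proof -
  define D where "D = division_points \<phi> l \<Gamma> \<inter> L"
  let ?P = "\<lambda>e. lead_coeff e = 1 \<and> \<phi> e ` D \<subseteq> \<Gamma>"
  \<comment> \<open>The monic \<open>l\<close> is itself a candidate, so the minimum is attained and
    \<open>module_exponent\<close> has its defining property.\<close>
  have "?P l"
    using l by (auto simp: D_def division_points_def)
  then have "?P (module_exponent \<phi> D \<Gamma>)"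
    unfolding module_exponent_def by (rule arg_min_natI)
  moreover have \<beta>D: "\<beta> \<in> D"
    using \<beta> by (simp add: D_def division_points_def)
  ultimately have e: "\<phi> (module_exponent \<phi> D \<Gamma>) \<beta> \<in> \<Gamma>" by blast
  define t u where "t = fst (bezout_coefficients (module_exponent \<phi> D \<Gamma>) l)"
    and "u = snd (bezout_coefficients (module_exponent \<phi> D \<Gamma>) l)"
  have "e_l L \<phi> l \<Gamma> = t * module_exponent \<phi> D \<Gamma> + u * l"
    by (simp add: e_l_def t_def u_def bezout_coefficients_fst_snd flip: D_def)
  then have "\<phi> (e_l L \<phi> l \<Gamma>) \<beta> = \<phi> t (\<phi> (module_exponent \<phi> D \<Gamma>) \<beta>) + \<phi> u (\<phi> l \<beta>)"
    by (simp add: scale_left_distrib)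
  with e \<beta>(2) show ?thesis
    using subspace_add[OF \<Gamma>] subspace_scale[OF \<Gamma>] by metis
qed

end

theorem theorem3p4:
  fixes L \<Gamma> :: "'f::{finite,field_gcd} kbar set"
    and \<phi> :: "'f poly \<Rightarrow> 'f kbar \<Rightarrow> 'f kbar"
    and l :: "'f poly"
  assumes "finite_extension L"
    and "drinfeld_module_rank_one L \<phi>"
    and "lead_coeff l = 1" and "Factorial_Ring.irreducible l"
    and "\<And>v. prime_over L l v \<Longrightarrow> good_reduction L \<phi> v"
    and "unramified_in l (max_separable L)"
    and "fg_submodule \<phi> L \<Gamma>"
  shows "\<phi> (e_l L \<phi> l \<Gamma>) ` kummer_kernel L \<phi> l \<Gamma> \<subseteq> \<phi> l ` \<Gamma>"
proof
  obtain c where "drinfeld_rank_one L c \<phi>"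
    using assms(2) by (auto simp: drinfeld_module_rank_one_def)
  then interpret drinfeld_prime L c \<phi> l
    using assms by (simp add: drinfeld_prime_def finite_extension_def)
  have \<Gamma>: "subspace \<Gamma>" "\<Gamma> \<subseteq> L"
    using assms(7) by (auto simp: fg_submodule_def)
  fix b assume "b \<in> \<phi> (e_l L \<phi> l \<Gamma>) ` kummer_kernel L \<phi> l \<Gamma>"
  then obtain a where a: "a \<in> kummer_kernel L \<phi> l \<Gamma>" and b: "b = \<phi> (e_l L \<phi> l \<Gamma>) a"
    by blast
  obtain \<beta> where \<beta>: "\<beta> \<in> L" "\<phi> l \<beta> = a"
    using kummer_kernel_division[OF \<Gamma>(2) a] by blast
  then have "\<phi> (e_l L \<phi> l \<Gamma>) \<beta> \<in> \<Gamma>"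
    using e_l_division[OF \<Gamma>(1) assms(3)] kummer_kernel_division(1)[OF \<Gamma>(2) a] by simp
  \<comment> \<open>\<open>A\<close> is commutative, so the factor
    \<open>e_l L \<phi> l \<Gamma>\<close> can be moved inside \<open>\<phi> l\<close>.\<close>
  moreover have "b = \<phi> l (\<phi> (e_l L \<phi> l \<Gamma>) \<beta>)"
    unfolding b \<beta>(2)[symmetric] by (rule scale_left_commute)
  ultimately show "b \<in> \<phi> l ` \<Gamma>" by blast
qed

end
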